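(* Let $n\geq 2$ be an odd integer and let $k > \max(5,(n-1)^2)$ be an integer. Then $$a^o_n(k) = 2a^o_n(k-1)-a^o_n(k-2)+n(n-1)\quad\text{for } k \text{ odd},$$ and $$a^o_n(k) = 2a^o_n(k-1)-a^o_n(k-2)\quad\text{for } k \text{ even}.$$
   Context: For integers $n\geq 1$ and $k\geq 0$, the $n$ by $k$ grid is the set of points $\{1,\dots,n\}\times\{1,\dots,k\}\subset\mathbb{R}^2$ (empty if $k=0$). $a^o_n(k)$ denotes the number of obtuse isosceles triangles of nonzero area formed by 3 distinct points of the $n$ by $k$ grid, i.e. the number of 3-element non-collinear subsets of the grid that are the vertices of a triangle with at least two sides of equal Euclidean length and with one angle strictly greater than $90^\circ$. *)

theory Defs
  imports "HOL-Analysis.Analysis"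
begin

text \<open>The plane is modelled by \<^typ>\<open>real \<times> real\<close>, whose library \<^const>\<open>dist\<close>, \<^const>\<open>norm\<close>
  and \<^const>\<open>inner\<close> are the Euclidean ones.\<close>

definition grid :: "nat \<Rightarrow> nat \<Rightarrow> (real \<times> real) set" where
  "grid n k = (\<lambda>(x, y). (real x, real y)) ` ({1..n} \<times> {1..k})"

text \<open>The angle in \<open>[0, \<pi>]\<close> at the vertex \<open>B\<close> between the rays \<open>BA\<close> and \<open>BC\<close>;
  it takes the junk value \<open>\<pi> / 2\<close> when \<open>A = B\<close> or \<open>C = B\<close>.\<close>

definition angle :: "'a::real_inner \<Rightarrow> 'a \<Rightarrow> 'a \<Rightarrow> real" where
  "angle A B C = arccos (inner (A - B) (C - B) / (norm (A - B) * norm (C - B)))"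

text \<open>A triangle is represented by the set of its three vertices. In \<open>isosceles\<close> and \<open>obtuse\<close>
  below, \<open>T = {A, B, C}\<close> together with \<open>card T = 3\<close> makes \<open>A\<close>, \<open>B\<close>, \<open>C\<close> distinct.\<close>

definition is_triangle :: "'a::real_inner set \<Rightarrow> bool" where
  "is_triangle T \<longleftrightarrow> card T = 3 \<and> \<not> collinear T"

definition isosceles :: "'a::real_inner set \<Rightarrow> bool" where
  "isosceles T \<longleftrightarrow> is_triangle T \<and> (\<exists>A B C. T = {A, B, C} \<and> dist B A = dist B C)"

definition obtuse :: "'a::real_inner set \<Rightarrow> bool" where
  "obtuse T \<longleftrightarrow> is_triangle T \<and> (\<exists>A B C. T = {A, B, C} \<and> angle A B C > pi / 2)"

definition obtuse_isosceles_count :: "nat \<Rightarrow> nat \<Rightarrow> nat" where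
  "obtuse_isosceles_count n k = card {T. T \<subseteq> grid n k \<and> isosceles T \<and> obtuse T}"

end

theory Submission
  imports Defs
begin

text \<open>Write \<open>a(k)\<close> for the number of obtuse isosceles triangles in the \<open>n\<close> by \<open>k\<close> grid. The
  triangles that miss the top row are those of the \<open>n\<close> by \<open>k - 1\<close> grid, the triangles that miss the
  bottom row are vertical translates of these, and those that miss both are translates of the
  triangles of the \<open>n\<close> by \<open>k - 2\<close> grid. By inclusion and exclusion (\<open>count_second_difference\<close>)
  the number \<open>a(k) - 2 a(k - 1) + a(k - 2)\<close> therefore counts the triangles with a vertex in the
  bottom row and a vertex in the top row.

  Put \<open>h = k - 1\<close> for the height of such a triangle and \<open>w = n - 1\<close> for the width of the grid, so
  that \<open>w\<^sup>2 \<le> h\<close>. The obtuse angle of an isosceles triangle lies between the two equal sides, at a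
  vertex called the apex. In such a tall and narrow grid the triangle is rigid:

  \<^item> If the apex and an end of the base were in opposite extreme rows, then the other equal side
    would have to be of full height as well, because horizontal displacements are too small to make
    up for a loss of height; both sides would be steep, point to the same side and enclose an acute
    angle (\<open>apex_row_not_extreme\<close>). Hence the base joins the two extreme rows.

  \<^item> If the apex is \<open>y\<close> rows above the lower end of the base, equality of the sides says that
    \<open>h (2 y - h)\<close> is a difference of two squares that are at most \<open>w\<^sup>2 \<le> h\<close>. So \<open>\<bar>2 y - h\<bar> \<le> 1\<close>, and
    the value \<open>1\<close> would make \<open>h\<close> odd and force \<open>h = w\<^sup>2\<close>, which is even like \<open>w\<close>
    (\<open>apex_row_central\<close>). Thus the apex is in the middle row.

  For even \<open>k\<close> there is no middle row and the count is \<open>0\<close>. For odd \<open>k\<close> the ends of the base have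
  equal horizontal distance to the apex; since the triangle is not degenerate, they are in the same
  column. The triangle is then given by the column \<open>a\<close> of its base and the column \<open>b \<noteq> a\<close>
  of its apex. All these \<open>n (n - 1)\<close> pairs occur, because the grid is so tall that the angle at
  the apex is always obtuse.\<close>

section \<open>Obtuse isosceles triangles\<close>

text \<open>Distinctness of the points is automatic: if \<open>B\<close> coincides with \<open>A\<close> or \<open>C\<close>, then the inner product
  vanishes and the angle has the default value \<open>\<pi> / 2\<close>.\<close>

lemma angle_gt_pi_half_iff:
  fixes A B C :: "'a::real_inner"
  shows "angle A B C > pi / 2 \<longleftrightarrow> inner (A - B) (C - B) < 0"
proof -
  let ?x = "inner (A - B) (C - B) / (norm (A - B) * norm (C - B))"
  have "\<bar>?x\<bar> \<le> 1"
    using Cauchy_Schwarz_ineq2[of "A - B" "C - B"]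
    by (cases "norm (A - B) * norm (C - B) = 0") (auto simp: divide_le_eq_1)
  then have "arccos 0 < arccos ?x \<longleftrightarrow> ?x < 0"
    by (intro arccos_less_mono) auto
  also have "?x < 0 \<longleftrightarrow> inner (A - B) (C - B) < 0"
    by (cases "A = B \<or> C = B") (auto simp: divide_less_0_iff mult_less_0_iff not_less)
  finally show ?thesis
    by (simp add: angle_def)
qed

definition obtuse_apex :: "'a::real_inner \<Rightarrow> 'a \<Rightarrow> 'a \<Rightarrow> bool" where
  "obtuse_apex A B C \<longleftrightarrow>
     dist B A = dist B C \<and> inner (A - B) (C - B) < 0 \<and> \<not> collinear {A, B, C}"

text \<open>Swapping the two ends of the base makes it possible to fix which of them is in the bottom
  row.\<close>

lemma obtuse_apex_commute: "obtuse_apex A B C \<longleftrightarrow> obtuse_apex C B A"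
  by (auto simp: obtuse_apex_def inner_commute insert_commute)

text \<open>The inner product at the end \<open>A\<close> of the base is half the square of the length of the base.\<close>

lemma base_angle_not_obtuse:
  fixes A B C :: "'a::real_inner"
  assumes "dist B A = dist B C"
  shows "inner (B - A) (C - A) \<ge> 0"
proof -
  have "inner (B - A) (B - A) = inner (B - C) (B - C)"
    using assms by (simp add: dist_norm norm_eq)
  then have "2 * inner (B - A) (C - A) = inner (C - A) (C - A)"
    by (simp add: inner_diff_left inner_diff_right inner_commute)
  then show ?thesis
    using inner_ge_zero[of "C - A"] by linarith
qed

text \<open>The definitions of \<^const>\<open>isosceles\<close> and \<^const>\<open>obtuse\<close> name the vertices independently of each
  other. As the base angles are not obtuse, the vertex of the obtuse angle must be the common end of
  the two equal sides, and one choice of names serves for both.\<close>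

lemma isosceles_obtuse_iff:
  "isosceles T \<and> obtuse T \<longleftrightarrow> (\<exists>A B C. T = {A, B, C} \<and> obtuse_apex A B C)"
proof
  assume "isosceles T \<and> obtuse T"
  then obtain A B C P Q R where T: "T = {A, B, C}" and d: "dist B A = dist B C"
    and nc: "\<not> collinear T"
    and PQR: "T = {P, Q, R}" and o: "inner (P - Q) (R - Q) < 0"
    unfolding isosceles_def obtuse_def is_triangle_def angle_gt_pi_half_iff by blast
  have ne: "P \<noteq> Q" "R \<noteq> Q" "P \<noteq> R"
    using o inner_ge_zero[of "P - Q"] by (auto simp del: inner_ge_zero)
  have in_T: "P \<in> {A, B, C}" "Q \<in> {A, B, C}" "R \<in> {A, B, C}"
    using T PQR by auto
  have "Q \<noteq> A"
  proof
    assume "Q = A"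
    then have "(P = B \<and> R = C) \<or> (P = C \<and> R = B)"
      using in_T ne by auto
    then show False
      using base_angle_not_obtuse[OF d] o \<open>Q = A\<close> by (auto simp: inner_commute)
  qed
  moreover have "Q \<noteq> C"
  proof
    assume "Q = C"
    then have "(P = A \<and> R = B) \<or> (P = B \<and> R = A)"
      using in_T ne by auto
    then show False
      using base_angle_not_obtuse[OF d[symmetric]] o \<open>Q = C\<close> by (auto simp: inner_commute)
  qed
  ultimately have "Q = B" "(P = A \<and> R = C) \<or> (P = C \<and> R = A)"
    using in_T ne by auto
  then have "inner (A - B) (C - B) < 0"
    using o by (auto simp: inner_commute)
  then show "\<exists>A B C. T = {A, B, C} \<and> obtuse_apex A B C"
    using T d nc unfolding obtuse_apex_def by blast
next
  assume "\<exists>A B C. T = {A, B, C} \<and> obtuse_apex A B C"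
  then obtain A B C where T: "T = {A, B, C}" and d: "dist B A = dist B C"
    and o: "inner (A - B) (C - B) < 0" and nc: "\<not> collinear T"
    unfolding obtuse_apex_def by blast
  have "A \<noteq> B" "C \<noteq> B" "A \<noteq> C"
    using o inner_ge_zero[of "A - B"] by (auto simp del: inner_ge_zero)
  then have "is_triangle T"
    using T nc by (auto simp: is_triangle_def)
  then show "isosceles T \<and> obtuse T"
    using T d o unfolding isosceles_def obtuse_def angle_gt_pi_half_iff by blast
qed

lemma obtuse_apex_translate:
  "obtuse_apex (v + A) (v + B) (v + C) \<longleftrightarrow> obtuse_apex A B C"
proof -
  have "collinear {v + A, v + B, v + C} \<longleftrightarrow> collinear {A, B, C}"
    by (simp add: collinear_def)
  then show ?thesis
    by (simp add: obtuse_apex_def)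
qed

lemma isosceles_obtuse_translate:
  fixes T :: "'a::real_inner set"
  shows "isosceles ((+) v ` T) \<and> obtuse ((+) v ` T) \<longleftrightarrow> isosceles T \<and> obtuse T"
proof -
  have *: "isosceles ((+) v ` T) \<and> obtuse ((+) v ` T)"
    if "isosceles T \<and> obtuse T" for v and T :: "'a set"
  proof -
    from that[unfolded isosceles_obtuse_iff]
    obtain A B C where "T = {A, B, C}" "obtuse_apex A B C"
      by blast
    then have "(+) v ` T = {v + A, v + B, v + C}" "obtuse_apex (v + A) (v + B) (v + C)"
      by (auto simp: obtuse_apex_translate)
    then show ?thesis
      unfolding isosceles_obtuse_iff by blast
  qed
  have unshift: "(+) (- v) ` (+) v ` T = T"
    by (simp add: image_image)
  show ?thesis
    using *[of T v] *[of "(+) v ` T" "- v", unfolded unshift] by blast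
qed

section \<open>The second difference as a count of triangles of full height\<close>

definition grid_triangles :: "nat \<Rightarrow> nat \<Rightarrow> (real \<times> real) set set" where
  "grid_triangles n k = {T. T \<subseteq> grid n k \<and> isosceles T \<and> obtuse T}"

definition full_height_triangles :: "nat \<Rightarrow> nat \<Rightarrow> (real \<times> real) set set" where
  "full_height_triangles n k =
     {T \<in> grid_triangles n k. 1 \<in> snd ` T \<and> real k \<in> snd ` T}"

lemma mem_grid:
  "p \<in> grid n k \<longleftrightarrow> (\<exists>x y. p = (real x, real y) \<and> x \<in> {1..n} \<and> y \<in> {1..k})"
  by (auto simp: grid_def)

lemma of_nat_mem_grid: "(real x, real y) \<in> grid n k \<longleftrightarrow> x \<in> {1..n} \<and> y \<in> {1..k}"
  by (auto simp: mem_grid)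

lemma finite_grid_triangles: "finite (grid_triangles n k)"
proof -
  have "finite (Pow (grid n k))"
    by (simp add: grid_def)
  then show ?thesis
    by (rule rev_finite_subset) (auto simp: grid_triangles_def)
qed

lemma lower_grid: "grid n k = {p \<in> grid n (Suc k). snd p \<noteq> real (Suc k)}"
  unfolding grid_def by (auto simp: le_Suc_eq simp del: of_nat_Suc)

lemma shifted_grid:
  "(+) (0, 1) ` grid n k = {p \<in> grid n (Suc k). snd p \<noteq> 1}"
proof (intro equalityI subsetI)
  fix p assume "p \<in> (+) (0, 1) ` grid n k"
  then obtain x y where "p = (real x, 1 + real y)" "x \<in> {1..n}" "y \<in> {1..k}"
    by (auto simp: mem_grid)
  then have "p = (real x, real (Suc y))" "x \<in> {1..n}" "Suc y \<in> {1..Suc k}" "snd p \<noteq> 1"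
    by auto
  then show "p \<in> {p \<in> grid n (Suc k). snd p \<noteq> 1}"
    unfolding mem_grid mem_Collect_eq by blast
next
  fix p assume "p \<in> {p \<in> grid n (Suc k). snd p \<noteq> 1}"
  then obtain x y where p: "p = (real x, real y)" "x \<in> {1..n}" "y \<in> {1..Suc k}" "y \<noteq> 1"
    by (auto simp: mem_grid)
  then have "y - 1 \<in> {1..k}" and shift: "p = (0, 1) + (real x, real (y - 1))"
    by auto
  then have "(real x, real (y - 1)) \<in> grid n k"
    using p(2) unfolding mem_grid by blast
  with shift show "p \<in> (+) (0, 1) ` grid n k"
    by blast
qed

lemma shifted_grid_triangles:
  "(`) ((+) (0, 1)) ` grid_triangles n k = {T \<in> grid_triangles n (Suc k). 1 \<notin> snd ` T}"
proof (intro equalityI subsetI)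
  fix T assume "T \<in> (`) ((+) (0, 1)) ` grid_triangles n k"
  then obtain S where S: "T = (+) (0, 1) ` S" "S \<subseteq> grid n k" "isosceles S \<and> obtuse S"
    by (auto simp: grid_triangles_def)
  then have "T \<subseteq> (+) (0, 1) ` grid n k" "isosceles T \<and> obtuse T"
    using isosceles_obtuse_translate by blast+
  then show "T \<in> {T \<in> grid_triangles n (Suc k). 1 \<notin> snd ` T}"
    unfolding shifted_grid grid_triangles_def by auto
next
  fix T assume T: "T \<in> {T \<in> grid_triangles n (Suc k). 1 \<notin> snd ` T}"
  then have "T \<subseteq> (+) (0, 1) ` grid n k"
    unfolding shifted_grid by (force simp: grid_triangles_def)
  then obtain S where "S \<subseteq> grid n k" "T = (+) (0, 1) ` S"
    by (auto simp: subset_image_iff)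
  then show "T \<in> (`) ((+) (0, 1)) ` grid_triangles n k"
    using T isosceles_obtuse_translate by (auto simp: grid_triangles_def)
qed

lemma card_shifted_grid_triangles:
  "card ((`) ((+) (0, 1)) ` grid_triangles n k) = obtuse_isosceles_count n k"
proof -
  have "inj ((`) ((+) (0::real, 1::real)))"
    by (simp add: inj_image_eq_iff inj_def)
  then show ?thesis
    by (simp add: card_image inj_on_subset obtuse_isosceles_count_def grid_triangles_def)
qed

text \<open>The triangles that miss the top row and those that miss the bottom row are equally many, and
  both families together leave out exactly the triangles of full height.\<close>

lemma count_second_difference:
  "int (obtuse_isosceles_count n (Suc (Suc k))) =
     2 * int (obtuse_isosceles_count n (Suc k)) - int (obtuse_isosceles_count n k)
     + int (card (full_height_triangles n (Suc (Suc k))))"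
proof -
  let ?F = "grid_triangles n" and ?shift = "(`) ((`) ((+) (0::real, 1::real)))"
  have low: "?F (Suc m) \<inter> {T. real (Suc m) \<notin> snd ` T} = ?F m" for m
    unfolding grid_triangles_def lower_grid[of n m]
    by (auto simp del: of_nat_Suc intro: rev_image_eqI)
  have parts: "?F (Suc (Suc k)) =
      (?F (Suc k) \<union> ?shift (?F (Suc k))) \<union> full_height_triangles n (Suc (Suc k))"
    unfolding shifted_grid_triangles
    unfolding low[of "Suc k", symmetric] full_height_triangles_def by blast
  have disjoint: "(?F (Suc k) \<union> ?shift (?F (Suc k))) \<inter> full_height_triangles n (Suc (Suc k)) = {}"
    unfolding shifted_grid_triangles
    unfolding low[of "Suc k", symmetric] full_height_triangles_def by blast
  have overlap: "?F (Suc k) \<inter> ?shift (?F (Suc k)) = ?shift (?F k)"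
    unfolding shifted_grid_triangles
    unfolding low[of "Suc k", symmetric] by blast
  have fin: "finite (full_height_triangles n (Suc (Suc k)))"
    by (simp add: full_height_triangles_def finite_grid_triangles)
  have card_F: "card (?F m) = obtuse_isosceles_count n m" for m
    by (simp add: obtuse_isosceles_count_def grid_triangles_def)
  have "card (?F (Suc k)) + card (?shift (?F (Suc k))) =
      card (?F (Suc k) \<union> ?shift (?F (Suc k))) + card (?shift (?F k))"
    using card_Un_Int[of "?F (Suc k)" "?shift (?F (Suc k))"]
    by (simp add: finite_grid_triangles overlap)
  moreover have "card (?F (Suc (Suc k))) =
      card (?F (Suc k) \<union> ?shift (?F (Suc k))) + card (full_height_triangles n (Suc (Suc k)))"
    unfolding parts by (rule card_Un_disjoint) (use disjoint fin finite_grid_triangles in auto)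
  ultimately show ?thesis
    unfolding card_F card_shifted_grid_triangles by linarith
qed

section \<open>Triangles of full height in a tall grid\<close>

text \<open>Here \<open>(p, h)\<close> and \<open>(q, y)\<close> are the two equal sides as vectors from the apex, of which the first
  has full height. If \<open>y < h\<close>, then \<open>q\<^sup>2 - p\<^sup>2 = h\<^sup>2 - y\<^sup>2 \<ge> 2 h - 1\<close> exceeds \<open>w\<^sup>2\<close>, which is impossible; so
  \<open>y = h\<close>, and then \<open>h\<^sup>2\<close> outweighs \<open>p q\<close>.\<close>

lemma apex_row_not_extreme:
  fixes p q h y w :: int
  assumes "\<bar>p\<bar> \<le> w" "\<bar>q\<bar> \<le> w" "w\<^sup>2 \<le> h" "h > 1" "0 \<le> y" "y \<le> h"
    and eq: "p\<^sup>2 + h\<^sup>2 = q\<^sup>2 + y\<^sup>2"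
  shows "p * q + h * y \<ge> 0"
proof (cases "y = h")
  case True
  then have "\<bar>p\<bar> = \<bar>q\<bar>"
    using eq by (simp add: power2_eq_iff abs_eq_iff)
  then have "\<bar>p * q\<bar> = q\<^sup>2"
    by (simp add: abs_mult power2_eq_square)
  also have "\<dots> \<le> w\<^sup>2"
    using assms(2) by (metis abs_ge_zero power2_abs power_mono)
  also have "\<dots> \<le> h * h"
    using assms(3,4) mult_left_mono[of 1 h h] by linarith
  finally show ?thesis
    using True by (simp add: abs_le_iff)
next
  case False
  then have "y\<^sup>2 \<le> (h - 1)\<^sup>2"
    using assms(5,6) by (intro power_mono) auto
  moreover have "q\<^sup>2 \<le> w\<^sup>2"
    using assms(2) by (metis abs_ge_zero power2_abs power_mono)
  moreover have "(h - 1)\<^sup>2 = h\<^sup>2 - 2 * h + 1"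
    by (simp add: power2_eq_square algebra_simps)
  ultimately have False
    using eq assms(3,4) zero_le_power2[of p] by linarith
  then show ?thesis ..
qed

text \<open>Here \<open>(p, - y)\<close> and \<open>(q, h - y)\<close> are the vectors from the apex to the ends of a base of full
  height. The equation reads \<open>h (2 y - h) = q\<^sup>2 - p\<^sup>2\<close>, whose right-hand side is at most \<open>w\<^sup>2 \<le> h\<close> in
  absolute value. Evenness of \<open>w\<close> excludes \<open>\<bar>2 y - h\<bar> = 1\<close>: that would give \<open>h = w\<^sup>2\<close> with \<open>h\<close> odd.\<close>

lemma apex_row_central:
  fixes p q h y w :: int
  assumes "\<bar>p\<bar> \<le> w" "\<bar>q\<bar> \<le> w" "w\<^sup>2 \<le> h" "h > 0" "even w"
    and eq: "p\<^sup>2 + y\<^sup>2 = q\<^sup>2 + (h - y)\<^sup>2"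
  shows "2 * y = h"
proof (rule ccontr)
  assume ne: "2 * y \<noteq> h"
  have le: "p\<^sup>2 \<le> w\<^sup>2" "q\<^sup>2 \<le> w\<^sup>2"
    using assms(1,2) by (metis abs_ge_zero power2_abs power_mono)+
  have prod: "h * (2 * y - h) = q\<^sup>2 - p\<^sup>2"
    using eq by (simp add: power2_eq_square algebra_simps)
  then have "h * \<bar>2 * y - h\<bar> = \<bar>q\<^sup>2 - p\<^sup>2\<bar>"
    using \<open>h > 0\<close> by (metis abs_mult abs_of_pos)
  also have "\<dots> \<le> w\<^sup>2"
    using le zero_le_power2[of p] zero_le_power2[of q] by linarith
  finally have le2: "h * \<bar>2 * y - h\<bar> \<le> w\<^sup>2" .
  then have "h * \<bar>2 * y - h\<bar> \<le> h * 1"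
    using assms(3) by linarith
  then have abs1: "\<bar>2 * y - h\<bar> = 1"
    using ne \<open>h > 0\<close> by simp
  then have "h = w\<^sup>2"
    using le2 assms(3) by simp
  then have "even h"
    using \<open>even w\<close> by simp
  then show False
    using abs1 by presburger
qed

text \<open>The metric conditions on grid points are Diophantine: they are stated over the integers, where
  differences of coordinates can be negative.\<close>

lemma dist_eq_iff_int:
  "dist (real b1, real b2) (real a1, real a2) = dist (real b1, real b2) (real c1, real c2) \<longleftrightarrow>
   (int a1 - int b1)\<^sup>2 + (int a2 - int b2)\<^sup>2 = (int c1 - int b1)\<^sup>2 + (int c2 - int b2)\<^sup>2"
proof -
  have *: "(dist (real x) (real y))\<^sup>2 = of_int ((int y - int x)\<^sup>2)" for x y
    by (simp add: dist_real_def power2_commute)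
  show ?thesis
    unfolding dist_Pair_Pair * real_sqrt_eq_iff of_int_add[symmetric] of_int_eq_iff ..
qed

lemma inner_less_0_iff_int:
  "inner ((real a1, real a2) - (real b1, real b2)) ((real c1, real c2) - (real b1, real b2)) < 0 \<longleftrightarrow>
   (int a1 - int b1) * (int c1 - int b1) + (int a2 - int b2) * (int c2 - int b2) < 0"
proof -
  have "inner ((real a1, real a2) - (real b1, real b2)) ((real c1, real c2) - (real b1, real b2)) =
    of_int ((int a1 - int b1) * (int c1 - int b1) + (int a2 - int b2) * (int c2 - int b2))"
    by simp
  then show ?thesis
    by (simp only: of_int_less_0_iff)
qed

lemma collinear_equal_steps:
  fixes A B C :: "'a::real_vector"
  assumes "A - B = B - C"
  shows "collinear {A, B, C}"
proof -
  have "A = B + 1 *\<^sub>R (A - B)" "B = B + 0 *\<^sub>R (A - B)" "C = B + (-1) *\<^sub>R (A - B)"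
    using assms by (simp_all add: algebra_simps)
  then show ?thesis
    unfolding collinear_alt by blast
qed

text \<open>In both orientations \<open>h \<bar>c2 - b2\<bar>\<close> is the vertical part of the inner product at the apex, since
  both ends of the base lie on the same side of an apex in an extreme row.\<close>

lemma apex_not_opposite_row:
  assumes big: "(int n - 1)\<^sup>2 < int k" "k > 2"
    and grid: "(real a1, real a2) \<in> grid n k" "(real b1, real b2) \<in> grid n k"
      "(real c1, real c2) \<in> grid n k"
    and apex: "obtuse_apex (real a1, real a2) (real b1, real b2) (real c1, real c2)"
  shows "{a2, b2} \<noteq> {1, k}"
proof
  assume "{a2, b2} = {1, k}"
  then have rows: "a2 = 1 \<and> b2 = k \<or> a2 = k \<and> b2 = 1"
    by (auto simp: doubleton_eq_iff)
  let ?p = "int a1 - int b1" and ?q = "int c1 - int b1" and ?h = "int k - 1"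
  have sq: "?p\<^sup>2 + (int a2 - int b2)\<^sup>2 = ?q\<^sup>2 + (int c2 - int b2)\<^sup>2"
    and neg: "?p * ?q + (int a2 - int b2) * (int c2 - int b2) < 0"
    using apex unfolding obtuse_apex_def dist_eq_iff_int inner_less_0_iff_int by simp_all
  have wid: "\<bar>?p\<bar> \<le> int n - 1" "\<bar>?q\<bar> \<le> int n - 1" and c: "1 \<le> c2" "c2 \<le> k"
    using grid by (auto simp: mem_grid)
  have "?p * ?q + ?h * \<bar>int c2 - int b2\<bar> \<ge> 0"
    using wid by (rule apex_row_not_extreme) (use rows big sq c in \<open>auto simp: power2_commute\<close>)
  moreover have "(int a2 - int b2) * (int c2 - int b2) = ?h * \<bar>int c2 - int b2\<bar>"
    using rows c by (auto simp: algebra_simps)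
  ultimately show False
    using neg by simp
qed

text \<open>Once the apex is in the middle row, its horizontal distances to the ends of the base agree.
  The ends cannot lie on different sides of it, as the apex would then be their midpoint.\<close>

lemma base_on_opposite_rows:
  assumes "odd n" and big: "(int n - 1)\<^sup>2 < int k" "k > 2"
    and grid: "(real a1, real 1) \<in> grid n k" "(real b1, real b2) \<in> grid n k"
      "(real c1, real k) \<in> grid n k"
    and apex: "obtuse_apex (real a1, real 1) (real b1, real b2) (real c1, real k)"
  shows "c1 = a1" "b1 \<noteq> a1" "k = 2 * b2 - 1"
proof -
  let ?p = "int a1 - int b1" and ?q = "int c1 - int b1" and ?h = "int k - 1"
  have sq: "?p\<^sup>2 + (int b2 - 1)\<^sup>2 = ?q\<^sup>2 + (?h - (int b2 - 1))\<^sup>2"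
    using apex unfolding obtuse_apex_def dist_eq_iff_int by (simp add: power2_commute)
  have wid: "\<bar>?p\<bar> \<le> int n - 1" "\<bar>?q\<bar> \<le> int n - 1"
    using grid by (auto simp: mem_grid)
  have "2 * (int b2 - 1) = ?h"
    using wid _ _ _ sq by (rule apex_row_central) (use big \<open>odd n\<close> in auto)
  then have k: "int k = 2 * int b2 - 1"
    by simp
  then show "k = 2 * b2 - 1"
    by linarith
  have "?p\<^sup>2 = ?q\<^sup>2"
    using sq k by simp
  moreover have "?p \<noteq> - ?q"
  proof
    assume "?p = - ?q"
    then have "real a1 - real b1 = real b1 - real c1"
      by linarith
    moreover have "real k = 2 * real b2 - 1"
      using k by linarith
    ultimately have "collinear {(real a1, real 1), (real b1, real b2), (real c1, real k)}"
      by (intro collinear_equal_steps) auto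
    then show False
      using apex by (simp add: obtuse_apex_def)
  qed
  ultimately show "c1 = a1" "b1 \<noteq> a1"
    by (auto simp: power2_eq_iff)
qed

text \<open>The base is in column \<open>a\<close> and the apex in column \<open>b\<close>. The half height \<open>m\<close> is the parameter, so that
  the middle row and the top row have the numbers \<open>m + 1\<close> and \<open>2 m + 1\<close>.\<close>

definition symmetric_triangle :: "nat \<Rightarrow> nat \<Rightarrow> nat \<Rightarrow> (real \<times> real) set" where
  "symmetric_triangle m a b = {(real a, 1), (real b, real (Suc m)), (real a, real (Suc (2 * m)))}"

text \<open>The inner product at the apex is \<open>(a - b)\<^sup>2 - m\<^sup>2\<close>.\<close>

lemma obtuse_apex_symmetric:
  assumes "a \<noteq> b" "\<bar>int a - int b\<bar> < int m"
  shows "obtuse_apex (real a, 1) (real b, real (Suc m)) (real a, real (Suc (2 * m)))"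
proof -
  have "(int a - int b)\<^sup>2 < (int m)\<^sup>2"
    using assms(2) abs_le_square_iff[of "int m" "int a - int b"] by simp
  then have "obtuse_apex (real a, real 1) (real b, real (Suc m)) (real a, real (Suc (2 * m)))
    \<longleftrightarrow> \<not> collinear {(real a, 1), (real b, real (Suc m)), (real a, real (Suc (2 * m)))}"
    unfolding obtuse_apex_def dist_eq_iff_int inner_less_0_iff_int
    by (simp add: power2_eq_square)
  moreover have False if col: "collinear {(real a, 1), (real b, real (Suc m)), (real a, real (Suc (2 * m)))}"
      (is "collinear ?T")
  proof -
    obtain u where u: "\<And>x y. x \<in> ?T \<Longrightarrow> y \<in> ?T \<Longrightarrow> \<exists>c. x - y = c *\<^sub>R u"
      using col unfolding collinear_def by blast
    obtain c where 1: "(real a, real (Suc (2 * m))) - (real a, 1) = c *\<^sub>R u"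
      using u by (meson insertI1 insertI2)
    obtain d where 2: "(real b, real (Suc m)) - (real a, 1) = d *\<^sub>R u"
      using u by (meson insertI1 insertI2)
    have "c * fst u = 0" "c * snd u = 2 * real m"
      using arg_cong[OF 1, of fst] arg_cong[OF 1, of snd] by auto
    then have "fst u = 0"
      using assms(2) by auto
    then show False
      using arg_cong[OF 2, of fst] assms(1) by simp
  qed
  ultimately show ?thesis
    by auto
qed

text \<open>The apex cannot be in an extreme row, because some end of the base would then be in the opposite
  one. So the ends of the base are in the two extreme rows.\<close>

lemma full_height_triangle_symmetric:
  assumes "odd n" and big: "(int n - 1)\<^sup>2 < int k" "k > 2"
    and "T \<in> full_height_triangles n k"
  obtains a b m where "k = Suc (2 * m)" "a \<in> {1..n}" "b \<in> {1..n}" "a \<noteq> b"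
    "T = symmetric_triangle m a b"
proof -
  have T: "T \<subseteq> grid n k" "1 \<in> snd ` T" "real k \<in> snd ` T" and "isosceles T \<and> obtuse T"
    using assms(4) by (auto simp: full_height_triangles_def grid_triangles_def)
  then obtain A B C where ABC: "T = {A, B, C}" "obtuse_apex A B C"
    unfolding isosceles_obtuse_iff by blast
  from T(1) obtain a1 a2 b1 b2 c1 c2
    where pts: "A = (real a1, real a2)" "B = (real b1, real b2)" "C = (real c1, real c2)"
    unfolding ABC by (auto simp: mem_grid)
  have grid: "(real a1, real a2) \<in> grid n k" "(real b1, real b2) \<in> grid n k"
      "(real c1, real c2) \<in> grid n k"
    using T(1) unfolding ABC pts by auto
  have apex: "obtuse_apex (real a1, real a2) (real b1, real b2) (real c1, real c2)"
    "obtuse_apex (real c1, real c2) (real b1, real b2) (real a1, real a2)"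
    using ABC(2) pts obtuse_apex_commute by auto
  have "a2 = 1 \<or> b2 = 1 \<or> c2 = 1" "a2 = k \<or> b2 = k \<or> c2 = k"
    using T(2,3) unfolding ABC pts by auto
  moreover have "{a2, b2} \<noteq> {1, k}" "{c2, b2} \<noteq> {1, k}"
    using apex_not_opposite_row[OF big] grid apex by blast+
  ultimately consider "a2 = 1" "c2 = k" | "c2 = 1" "a2 = k"
    using big(2) by auto
  then show ?thesis
  proof cases
    case 1
    have *: "c1 = a1" "b1 \<noteq> a1" "k = 2 * b2 - 1"
      using base_on_opposite_rows[OF assms(1) big, of a1 b1 b2 c1] grid apex 1 by auto
    then have b2: "k = Suc (2 * (b2 - 1))" "b2 = Suc (b2 - 1)"
      using big(2) by auto
    have "T = symmetric_triangle (b2 - 1) a1 b1"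
      unfolding ABC pts symmetric_triangle_def using * 1 b2 by simp
    then show ?thesis
      using that[OF b2(1), of a1 b1] * grid by (auto simp: mem_grid)
  next
    case 2
    have *: "a1 = c1" "b1 \<noteq> c1" "k = 2 * b2 - 1"
      using base_on_opposite_rows[OF assms(1) big, of c1 b1 b2 a1] grid apex 2 by auto
    then have b2: "k = Suc (2 * (b2 - 1))" "b2 = Suc (b2 - 1)"
      using big(2) by auto
    have "T = symmetric_triangle (b2 - 1) c1 b1"
      unfolding ABC pts symmetric_triangle_def using * 2 b2 by (simp add: insert_commute)
    then show ?thesis
      using that[OF b2(1), of c1 b1] * grid by (auto simp: mem_grid)
  qed
qed

lemma symmetric_triangle_full_height:
  assumes "n \<le> m" "a \<in> {1..n}" "b \<in> {1..n}" "a \<noteq> b"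
  shows "symmetric_triangle m a b \<in> full_height_triangles n (Suc (2 * m))"
proof -
  have "\<bar>int a - int b\<bar> < int m"
    using assms by auto
  then have "isosceles (symmetric_triangle m a b) \<and> obtuse (symmetric_triangle m a b)"
    using obtuse_apex_symmetric[OF \<open>a \<noteq> b\<close>]
    unfolding isosceles_obtuse_iff symmetric_triangle_def by blast
  moreover have "symmetric_triangle m a b \<subseteq> grid n (Suc (2 * m))"
  proof -
    have "(real a, real 1) \<in> grid n (Suc (2 * m))" "(real b, real (Suc m)) \<in> grid n (Suc (2 * m))"
      "(real a, real (Suc (2 * m))) \<in> grid n (Suc (2 * m))"
      using assms by (auto simp: of_nat_mem_grid simp del: of_nat_Suc of_nat_1)
    then show ?thesis
      by (simp add: symmetric_triangle_def)
  qed
  ultimately show ?thesis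
    by (simp add: full_height_triangles_def grid_triangles_def symmetric_triangle_def)
qed

text \<open>The only vertex in the bottom row shows the column of the base, and the only vertex in the
  middle row that of the apex.\<close>

lemma symmetric_triangle_inject:
  assumes "m > 0" "symmetric_triangle m a b = symmetric_triangle m a' b'"
  shows "a = a'" "b = b'"
proof -
  have row1: "(real x, 1) \<in> symmetric_triangle m a b \<longleftrightarrow> x = a"
    and apex: "(real x, real (Suc m)) \<in> symmetric_triangle m a b \<longleftrightarrow> x = b" for x a b
    using assms(1) by (auto simp: symmetric_triangle_def)
  show "a = a'"
    using row1[of a a b] row1[of a a' b'] assms(2) by simp
  show "b = b'"
    using apex[of b a b] apex[of b a' b'] assms(2) by simp
qed

lemma card_off_diagonal:
  "card {(a, b) \<in> {1..n} \<times> {1..n}. a \<noteq> b} = n * (n - 1)"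
proof -
  have "{(a, b) \<in> {1..n} \<times> {1..n}. a \<noteq> b} = (SIGMA a:{1..n}. {1..n} - {a})"
    by auto
  then show ?thesis
    by simp
qed

lemma card_full_height_triangles_odd:
  assumes "odd n" and "(int n - 1)\<^sup>2 < int (Suc (2 * m))" and "n \<le> m"
  shows "card (full_height_triangles n (Suc (2 * m))) = n * (n - 1)"
proof -
  let ?P = "{(a, b) \<in> {1..n} \<times> {1..n}. a \<noteq> b}"
  have "m > 0"
    using \<open>odd n\<close> \<open>n \<le> m\<close> by (cases m) auto
  have "full_height_triangles n (Suc (2 * m)) = (\<lambda>(a, b). symmetric_triangle m a b) ` ?P"
  proof (intro equalityI subsetI)
    fix T assume T: "T \<in> full_height_triangles n (Suc (2 * m))"
    have "Suc (2 * m) > 2"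
      using \<open>m > 0\<close> by simp
    then obtain a b m' where "Suc (2 * m) = Suc (2 * m')" "a \<in> {1..n}" "b \<in> {1..n}" "a \<noteq> b"
      "T = symmetric_triangle m' a b"
      using T by (rule full_height_triangle_symmetric[OF assms(1,2)])
    then show "T \<in> (\<lambda>(a, b). symmetric_triangle m a b) ` ?P"
      by auto
  qed (use symmetric_triangle_full_height[OF \<open>n \<le> m\<close>] in auto)
  moreover have "inj_on (\<lambda>(a, b). symmetric_triangle m a b) ?P"
    using symmetric_triangle_inject[OF \<open>m > 0\<close>] by (auto simp: inj_on_def)
  ultimately show ?thesis
    by (simp only: card_image card_off_diagonal)
qed

theorem theorem9:
  fixes n k :: nat
  assumes "n \<ge> 2" and "odd n" and "k > max 5 ((n - 1)^2)"
  shows "(odd k \<longrightarrow> int (obtuse_isosceles_count n k)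
             = 2 * int (obtuse_isosceles_count n (k - 1)) - int (obtuse_isosceles_count n (k - 2))
               + int n * (int n - 1))
       \<and> (even k \<longrightarrow> int (obtuse_isosceles_count n k)
             = 2 * int (obtuse_isosceles_count n (k - 1)) - int (obtuse_isosceles_count n (k - 2)))"
proof -
  have "int ((n - 1)\<^sup>2) < int k"
    using assms(3) by (simp only: of_nat_less_iff)
  then have big: "(int n - 1)\<^sup>2 < int k" "k > 2"
    using assms(1,3) by (simp_all add: of_nat_diff)
  have difference: "int (obtuse_isosceles_count n k) =
      2 * int (obtuse_isosceles_count n (k - 1)) - int (obtuse_isosceles_count n (k - 2))
      + int (card (full_height_triangles n k))"
    using count_second_difference[of n "k - 2"] big(2)
    by (simp add: Suc_diff_Suc numeral_2_eq_2)
  have "card (full_height_triangles n k) = n * (n - 1)" if "odd k"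
  proof -
    define m where "m = k div 2"
    have m: "k = Suc (2 * m)"
      using odd_two_times_div_two_succ[OF that] by (simp add: m_def)
    \<comment> \<open>For \<open>n = 3\<close> the bound \<open>(n - 1)\<^sup>2 < k\<close> would allow \<open>k = 5\<close>, that is \<open>m = 2\<close>, where columns at
      distance \<open>2\<close> give a right angle; this is where \<open>k > 5\<close> enters. From \<open>n = 5\<close> on, \<open>(n - 1)\<^sup>2 \<ge> 4 (n - 1)\<close> is large enough.\<close>
    have "n \<le> m"
    proof (cases "n = 3")
      case True
      then show ?thesis
        using assms(3) m by simp
    next
      case False
      then have "n \<ge> 5"
        using assms(1,2) by presburger
      then have "4 * (int n - 1) \<le> (int n - 1)\<^sup>2"
        unfolding power2_eq_square by (intro mult_right_mono) auto
      then have "4 * (int n - 1) < 2 * int m + 1"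
        using big(1) m by simp
      then show ?thesis
        using \<open>n \<ge> 5\<close> by presburger
    qed
    then show ?thesis
      using card_full_height_triangles_odd[OF assms(2)] big(1) m by blast
  qed
  moreover have "full_height_triangles n k = {}" if "even k"
  proof -
    have False if "T \<in> full_height_triangles n k" for T
      using assms(2) big that by (rule full_height_triangle_symmetric) (use \<open>even k\<close> in simp)
    then show ?thesis
      by blast
  qed
  moreover have "int (n * (n - 1)) = int n * (int n - 1)"
    using assms(1) by (simp add: of_nat_diff)
  ultimately show ?thesis
    using difference by simp
qed

end
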